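(* Let $p,A\in\mathbb{C}$, let $f(x)=\Delta_p(x)\bigl(1-A\Delta_{-p}(x)\bigr)$ and let $p_s=p_s^f$. Then for every $s\in\mathbb{C}$: $$f\!\left(\tfrac{\partial}{\partial\alpha}\right)\ln\frac{p_s(\alpha)}{p_{1-s}(\alpha)}=\left(f\!\left(s\tfrac{\partial}{\partial\alpha}\right)-f\!\left((1-s)\tfrac{\partial}{\partial\alpha}\right)\right)\ln\alpha,$$ $$f\!\left(\tfrac{\partial}{\partial\alpha}\right)\left(\frac{\dot p_s(\alpha)}{p_s(\alpha)}+\frac{\dot p_{1-s}(\alpha)}{p_{1-s}(\alpha)}\right)=\frac{1}{s}p_{-1}\!\left(\frac{\alpha}{s}\right)+\frac{1}{1-s}p_{-1}\!\left(\frac{\alpha}{1-s}\right).$$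
   Context: $\Delta_p(x)=(e^{px}-1)/p$ for $p\neq0$ and $\Delta_0(x)=x$. For $f\in x+x^2\mathbb{C}[[x]]$ (power series with zero constant term and linear coefficient 1) and $s\in\mathbb{C}$, write $(x/f(x))^s=\sum_{n\ge0}q_n(s)x^n/n!$ (each $q_n$ a polynomial in $s$) and define the formal series $p_s^f(\alpha)=\sum_{n\ge0}\binom{s-1}{n}q_n(s)\alpha^{s-n}\in\alpha^s+\alpha^{s-1}\mathbb{C}[[\alpha^{-1}]]$ (for $s=n\in\mathbb{Z}_{\ge0}$ these are the binomial-type polynomials with $\sum_n p_n(\alpha)x^n/n!=e^{\alpha f^{inv}(x)}$). One works with formal series $\sum_{j\ge0}\alpha^{c-j}(a_j+b_j\ln\alpha)$, where $\ln\alpha$ is a formal element; $D=\partial/\partial\alpha$ acts termwise by $D\alpha^q=q\alpha^{q-1}$ and $D(\alpha^q\ln\alpha)=\alpha^{q-1}+q\alpha^{q-1}\ln\alpha$, and for a power series $g(x)=\sum g_kx^k$ one sets $g(cD)=\sum g_kc^kD^k$. For $h\in\alpha^c(1+\alpha^{-1}\mathbb{C}[[\alpha^{-1}]])$, $\ln h:=c\ln\alpha+\log(1+(\alpha^{-c}h-1))$ expanded as a series. $\dot p_s:=\partial p_s/\partial s$, differentiated coefficientwise with $\partial_s\alpha^{s-n}=\alpha^{s-n}\ln\alpha$. If $p_{-1}(\alpha)=\sum_{n\ge0}c_n\alpha^{-1-n}$, then for $c\in\mathbb{C}$ the notation $\frac1c p_{-1}(\alpha/c)$ means $\sum_{n\ge0}c_nc^n\alpha^{-1-n}$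 (also defined for $c=0$). *)

theory Defs
  imports "HOL-Analysis.Analysis" "HOL-Library.Function_Algebras"
begin

definition Delta :: "complex \<Rightarrow> complex fps" where
  "Delta p = (if p = 0 then fps_X else fps_const (1 / p) * (fps_exp p - 1))"

(* u ^ s for a power series u with constant term 1: the binomial series (1 + X) ^ s at u - 1. *)
definition fps_cpow :: "complex fps \<Rightarrow> complex \<Rightarrow> complex fps" where
  "fps_cpow u s = fps_binomial s oo (u - 1)"

definition qpoly :: "complex fps \<Rightarrow> nat \<Rightarrow> complex \<Rightarrow> complex" where
  "qpoly f n s = fact n * fps_nth (fps_cpow (fps_X / f) s) n"

(* The coefficient of \<alpha> ^ (s - n) in p_s. *)
definition pcoeff :: "complex fps \<Rightarrow> nat \<Rightarrow> complex \<Rightarrow> complex" where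
  "pcoeff f n s = ((s - 1) gchoose n) * qpoly f n s"

(* A formal series in complex powers of \<alpha>, of degree at most 1 in the formal element ln \<alpha>,
   is given by its coefficients: q is sent to the pair formed by the coefficients of \<alpha> ^ q and
   of \<alpha> ^ q * ln \<alpha>.  Equality is thus equality of all coefficients, and + and - are pointwise. *)
type_synonym log_series = "complex \<Rightarrow> complex \<times> complex"

(* The series \<Sum>j. \<alpha> ^ (c - j) * (a_j + b_j * ln \<alpha>).  For each q the sum below has at most one
   term. *)
definition ls :: "complex \<Rightarrow> complex fps \<Rightarrow> complex fps \<Rightarrow> log_series" where
  "ls c a b = (\<lambda>q. \<Sum>j | q = c - of_nat j. (fps_nth a j, fps_nth b j))"

definition ln_alpha :: log_series where
  "ln_alpha = ls 0 0 1"

definition ls_D :: "log_series \<Rightarrow> log_series" where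
  "ls_D F = (\<lambda>q. ((q + 1) * fst (F (q + 1)) + snd (F (q + 1)), (q + 1) * snd (F (q + 1))))"

(* The operator g(c D).  If F is of the form "ls e a b" then, for each exponent q, only finitely
   many of the series D ^ k F have a nonzero coefficient at q, and the sum is finite. *)
definition ls_op :: "complex fps \<Rightarrow> complex \<Rightarrow> log_series \<Rightarrow> log_series" where
  "ls_op g c F = (\<lambda>q. \<Sum>k | (ls_D ^^ k) F q \<noteq> 0.
     (fps_nth g k * c ^ k * fst ((ls_D ^^ k) F q), fps_nth g k * c ^ k * snd ((ls_D ^^ k) F q)))"

(* The largest exponent c occurring in F, all other exponents being of the form c - j with j a
   natural number; the two power series in 1 / \<alpha> below are then taken relative to \<alpha> ^ c, so that
   F = ls (lead_exp F) (pow_part F) (log_part F). *)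
definition lead_exp :: "log_series \<Rightarrow> complex" where
  "lead_exp F = (THE c. F c \<noteq> 0 \<and> (\<forall>q. F q \<noteq> 0 \<longrightarrow> (\<exists>j::nat. q = c - of_nat j)))"

definition pow_part :: "log_series \<Rightarrow> complex fps" where
  "pow_part F = Abs_fps (\<lambda>j. fst (F (lead_exp F - of_nat j)))"

definition log_part :: "log_series \<Rightarrow> complex fps" where
  "log_part F = Abs_fps (\<lambda>j. snd (F (lead_exp F - of_nat j)))"

(* The quotient F / G for G free of ln \<alpha>. *)
definition ls_div :: "log_series \<Rightarrow> log_series \<Rightarrow> log_series" where
  "ls_div F G = ls (lead_exp F - lead_exp G)
     (pow_part F * inverse (pow_part G)) (log_part F * inverse (pow_part G))"

(* ln h for h in \<alpha> ^ c * (1 + (1 / \<alpha>) C[[1 / \<alpha>]]); note that fps_ln 1 is the series of log (1 + X). *)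
definition ls_ln :: "log_series \<Rightarrow> log_series" where
  "ls_ln h = ls 0 (fps_ln 1 oo (pow_part h - 1)) (fps_const (lead_exp h))"

definition p_series :: "complex fps \<Rightarrow> complex \<Rightarrow> log_series" where
  "p_series f s = ls s (Abs_fps (\<lambda>n. pcoeff f n s)) 0"

definition p_dot :: "complex fps \<Rightarrow> complex \<Rightarrow> log_series" where
  "p_dot f s = ls s (Abs_fps (\<lambda>n. deriv (pcoeff f n) s)) (Abs_fps (\<lambda>n. pcoeff f n s))"

(* The series (1 / c) * p_{-1}(\<alpha> / c), also for c = 0, where 0 ^ 0 = 1 makes it \<alpha> ^ (-1). *)
definition p_minus1_scaled :: "complex fps \<Rightarrow> complex \<Rightarrow> log_series" where
  "p_minus1_scaled f c = ls (- 1) (Abs_fps (\<lambda>n. pcoeff f n (- 1) * c ^ n)) 0"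

lemma ls_nth: "ls c a b (c - of_nat j) = (fps_nth a j, fps_nth b j)"
proof -
  have "{i. c - of_nat j = c - (of_nat i :: complex)} = {j}" by auto
  then show ?thesis by (simp add: ls_def)
qed

lemma ls_outside: "(\<And>j::nat. q \<noteq> c - of_nat j) \<Longrightarrow> ls c a b q = 0"
  by (simp add: ls_def)

lemma ls_D_ls:
  "ls_D (ls c a b) = ls (c - 1)
     (Abs_fps (\<lambda>j. (c - of_nat j) * fps_nth a j + fps_nth b j))
     (Abs_fps (\<lambda>j. (c - of_nat j) * fps_nth b j))" (is "_ = ?R")
proof
  fix q
  show "ls_D (ls c a b) q = ?R q"
  proof (cases "\<exists>j::nat. q = c - 1 - of_nat j")
    case True
    then obtain j :: nat where q: "q = c - 1 - of_nat j" by blast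
    then have "q + 1 = c - of_nat j" by simp
    then have "ls_D (ls c a b) q
        = ((c - of_nat j) * fps_nth a j + fps_nth b j, (c - of_nat j) * fps_nth b j)"
      by (simp add: ls_D_def ls_nth)
    then show ?thesis unfolding q by (simp add: ls_nth)
  next
    case False
    then have "q + 1 \<noteq> c - of_nat j" for j :: nat by (auto simp: algebra_simps)
    then have "ls c a b (q + 1) = 0" by (rule ls_outside)
    moreover have "?R q = 0" using False by (intro ls_outside) blast
    ultimately show ?thesis by (simp add: ls_D_def zero_prod_def)
  qed
qed

lemma ls_lead_exp:
  assumes "fps_nth a 0 \<noteq> 0 \<or> fps_nth b 0 \<noteq> 0"
  shows "lead_exp (ls c a b) = c" "pow_part (ls c a b) = a" "log_part (ls c a b) = b"
proof -
  have nz: "ls c a b c \<noteq> 0"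
    using ls_nth[of c a b 0] assms by (auto simp: zero_prod_def)
  have supp: "\<exists>j::nat. q = c - of_nat j" if "ls c a b q \<noteq> 0" for q
    using that ls_outside by metis
  show c: "lead_exp (ls c a b) = c"
    unfolding lead_exp_def
  proof (rule the_equality)
    fix d assume d: "ls c a b d \<noteq> 0 \<and> (\<forall>q. ls c a b q \<noteq> 0 \<longrightarrow> (\<exists>j::nat. q = d - of_nat j))"
    then obtain i j :: nat where "c = d - of_nat i" "d = c - of_nat j"
      using nz supp by blast
    moreover from this have "d + c = d + c - of_nat (i + j)"
      by (metis add.commute add_diff_eq diff_diff_add of_nat_add diff_add_eq)
    then have "(of_nat (i + j) :: complex) = 0" by (simp del: of_nat_add)
    then have "i = 0" by (simp only: of_nat_eq_0_iff add_is_0)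
    ultimately show "d = c" by simp
  qed (use nz supp in blast)
  show "pow_part (ls c a b) = a" "log_part (ls c a b) = b"
    by (simp_all add: pow_part_def log_part_def c ls_nth fps_eq_iff)
qed

lemma ls_div_ls:
  assumes "fps_nth a 0 \<noteq> 0 \<or> fps_nth b 0 \<noteq> 0" "fps_nth v 0 \<noteq> 0"
  shows "ls_div (ls c a b) (ls d v 0) = ls (c - d) (a * inverse v) (b * inverse v)"
  using assms by (simp add: ls_div_def ls_lead_exp)

end

(* Put X = 1 / \<alpha> and p_s(\<alpha>) = \<alpha>^s u(X), v being the series of p_{1-s}.  As an operator formula
   p_s = \<alpha> (D / f(D))^s \<alpha>^(s-1), so P_s = p_s / \<alpha> satisfies \<alpha> f(D) P_s = (s - 1) f'(D) P_s.  For
   p \<noteq> 0 the operators f(D) and f'(D) are combinations of the translations by p, 0, -p, and this is a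
   second order difference equation.  The Casoratian-like combination
     Y(\<alpha>) = (\<alpha> + (1-s) p) P_s(\<alpha>+p) P_{1-s}(\<alpha>) - (\<alpha> + s p) P_s(\<alpha>) P_{1-s}(\<alpha>+p)
   satisfies (p - A) Y(\<alpha>) + A Y(\<alpha>-p) = 0, hence Y = 0 by looking at its leading coefficient.  So
   h = p_s / p_{1-s} has h(\<alpha>+p) / h(\<alpha>) = (\<alpha> + s p) / (\<alpha> + (1-s) p), which does not involve A; that is,
     (e^{pD} - 1) ln h = (e^{spD} - e^{(1-s)pD}) ln \<alpha>,
   and the first identity follows from f(x) (e^{spx} - e^{(1-s)px}) = (e^{px} - 1) (f(sx) - f((1-s)x)).
   For p = 0 a recursion shows u = v.  The second identity is the derivative of the first in s. *)
theory Submission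
  imports Defs
begin

section \<open>Differential operators on series in 1 / alpha\<close>

text \<open>A series \<open>\<alpha>\<^sup>c a(1 / \<alpha>)\<close> is represented by the exponent \<open>c\<close> and the power series \<open>a\<close>;
  \<open>diff_op g c a\<close> is the power series of \<open>\<alpha>\<^bsup>-c\<^esup> g(D) (\<alpha>\<^sup>c a(1 / \<alpha>))\<close>, with the exponent \<open>c\<close> kept.\<close>

definition diff_op :: "complex fps \<Rightarrow> complex \<Rightarrow> complex fps \<Rightarrow> complex fps" where
  "diff_op g c a = Abs_fps (\<lambda>n. \<Sum>k\<le>n. fps_nth g k * pochhammer (c - of_nat n + 1) k * fps_nth a (n - k))"

lemma diff_op_nth:
  "fps_nth (diff_op g c a) n
     = (\<Sum>k\<le>n. fps_nth g k * pochhammer (c - of_nat n + 1) k * fps_nth a (n - k))"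
  by (simp add: diff_op_def)

lemma diff_op_add: "diff_op (g + h) c a = diff_op g c a + diff_op h c a"
  by (simp add: fps_eq_iff diff_op_nth algebra_simps sum.distrib)

lemma diff_op_diff: "diff_op (g - h) c a = diff_op g c a - diff_op h c a"
  by (simp add: fps_eq_iff diff_op_nth algebra_simps sum_subtractf)

lemma diff_op_const_mult: "diff_op (fps_const b * g) c a = fps_const b * diff_op g c a"
  by (simp add: fps_eq_iff diff_op_nth algebra_simps sum_distrib_left)

lemma diff_op_1: "diff_op 1 c a = a"
proof (rule fps_ext)
  fix n
  have "fps_nth (diff_op 1 c a) n = (\<Sum>k\<le>n. if k = 0 then fps_nth a n else 0)"
    unfolding diff_op_nth by (rule sum.cong) auto
  then show "fps_nth (diff_op 1 c a) n = fps_nth a n" by (simp add: sum.delta)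
qed

lemma diff_op_right_diff: "diff_op g c (a - b) = diff_op g c a - diff_op g c b"
  by (simp add: fps_eq_iff diff_op_nth algebra_simps sum_subtractf)

lemma diff_op_right_const_mult: "diff_op g c (fps_const b * a) = fps_const b * diff_op g c a"
  by (simp add: fps_eq_iff diff_op_nth algebra_simps sum_distrib_left)

lemma diff_op_right_1: "fps_nth (diff_op g c 1) n = fps_nth g n * pochhammer (c - of_nat n + 1) n"
proof -
  have "fps_nth (diff_op g c 1) n
      = (\<Sum>k\<le>n. if k = n then fps_nth g n * pochhammer (c - of_nat n + 1) n else 0)"
    unfolding diff_op_nth by (rule sum.cong) auto
  then show ?thesis by (simp add: sum.delta')
qed

text \<open>In the variable X = 1 / \<alpha> the derivation D is - X^2 d/dX, here conjugated by
  \<alpha>^c.\<close>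

lemma diff_op_X: "diff_op fps_X c a = fps_X * (fps_const c * a - fps_X * fps_deriv a)"
proof (rule fps_ext)
  fix n
  have "fps_nth (diff_op fps_X c a) n
      = (\<Sum>k\<le>n. if k = 1 then (c - of_nat n + 1) * fps_nth a (n - 1) else 0)"
    unfolding diff_op_nth by (rule sum.cong) auto
  then show "fps_nth (diff_op fps_X c a) n
      = fps_nth (fps_X * (fps_const c * a - fps_X * fps_deriv a)) n"
    by (cases n) (auto simp: sum.delta' algebra_simps)
qed

text \<open>Composition of operators is multiplication of symbols: the falling factorial produced by
  D^(k+l) splits into the parts produced by D^l and then by D^k.\<close>

lemma diff_op_mult: "diff_op (g * h) c a = diff_op g c (diff_op h c a)"
proof (rule fps_ext)
  fix n
  define z where "z = c - of_nat n + 1"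
  define G where "G = (\<lambda>k l. fps_nth g k * fps_nth h l * pochhammer z (k + l) * fps_nth a (n - (k + l)))"
  have "fps_nth (diff_op g c (diff_op h c a)) n = (\<Sum>k\<le>n. \<Sum>l\<le>n-k. G k l)"
    unfolding diff_op_nth sum_distrib_left
  proof (intro sum.cong refl)
    fix k l assume "k \<in> {..n}" "l \<in> {..n - k}"
    then have "pochhammer z (k + l) = pochhammer z k * pochhammer (c - of_nat (n - k) + 1) l"
      by (simp add: pochhammer_product' z_def of_nat_diff algebra_simps)
    then show "fps_nth g k * pochhammer (c - of_nat n + 1) k *
          (fps_nth h l * pochhammer (c - of_nat (n - k) + 1) l * fps_nth a (n - k - l)) = G k l"
      by (simp add: G_def z_def)
  qed
  also have "\<dots> = (\<Sum>(k, l) \<in> {(i, j). i + j \<le> n}. G k l)"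
    by (subst sum.Sigma) (auto intro!: sum.cong)
  also have "\<dots> = (\<Sum>m\<le>n. \<Sum>i\<le>m. G i (m - i))"
    by (rule sum.triangle_reindex_eq)
  also have "\<dots> = fps_nth (diff_op (g * h) c a) n"
    unfolding diff_op_nth fps_mult_nth sum_distrib_right atLeast0AtMost
    by (intro sum.cong refl) (simp add: G_def z_def)
  finally show "fps_nth (diff_op (g * h) c a) n = fps_nth (diff_op g c (diff_op h c a)) n" ..
qed

text \<open>The leading term a_m \<alpha>^(c-m) would go to g_1 (c-m) a_m \<alpha>^(c-m-1), and c -
  m is not 0.\<close>

lemma diff_op_eq_0D:
  assumes "fps_nth g 0 = 0" "fps_nth g 1 \<noteq> 0" "\<And>n::nat. c \<noteq> of_nat n" "diff_op g c a = 0"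
  shows "a = 0"
proof (rule ccontr)
  assume "a \<noteq> 0"
  define m where "m = subdegree a"
  have "fps_nth (diff_op g c a) (Suc m)
      = (\<Sum>k\<le>Suc m. if k = 1 then fps_nth g 1 * (c - of_nat m) * fps_nth a m else 0)"
    unfolding diff_op_nth
  proof (intro sum.cong refl)
    fix k assume "k \<in> {..Suc m}"
    consider "k = 0" | "k = 1" | "2 \<le> k" by linarith
    then show "fps_nth g k * pochhammer (c - of_nat (Suc m) + 1) k * fps_nth a (Suc m - k)
        = (if k = 1 then fps_nth g 1 * (c - of_nat m) * fps_nth a m else 0)"
    proof cases
      case 3
      then have "fps_nth a (Suc m - k) = 0"
        using \<open>k \<in> _\<close> by (intro nth_less_subdegree_zero) (auto simp: m_def)
      then show ?thesis using 3 by simp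
    qed (use assms(1) in auto)
  qed
  also have "\<dots> = fps_nth g 1 * (c - of_nat m) * fps_nth a m" by (simp add: sum.delta')
  finally show False
    using assms \<open>a \<noteq> 0\<close> by (simp add: m_def)
qed

section \<open>Complex powers of power series with constant term 1\<close>

lemma fps_cpow_add:
  assumes "fps_nth u 0 = 1"
  shows "fps_cpow u (a + b) = fps_cpow u a * fps_cpow u b"
  using assms by (simp add: fps_cpow_def fps_binomial_add_mult fps_compose_mult_distrib)

lemma fps_cpow_of_nat:
  assumes "fps_nth u 0 = 1"
  shows "fps_cpow u (of_nat n) = u ^ n"
proof -
  have "(1 + fps_X) oo (u - 1) = u"
    using assms by (simp add: fps_compose_add_distrib fps_X_fps_compose_startby0)
  then show ?thesis
    using assms by (simp add: fps_cpow_def fps_binomial_of_nat fps_compose_power[symmetric])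
qed

lemma fps_cpow_minus_1:
  assumes "fps_nth u 0 = 1"
  shows "fps_cpow u (- 1) = inverse u"
proof -
  have "fps_cpow u (-1) * u = 1"
    using fps_cpow_add[OF assms, of "-1" 1] fps_cpow_of_nat[OF assms, of 1] fps_cpow_of_nat[OF assms, of 0]
    by simp
  then show ?thesis by (metis fps_inverse_unique mult.commute)
qed

lemma fps_cpow_nth_0 [simp]: "fps_nth (fps_cpow u s) 0 = 1"
  by (simp add: fps_cpow_def)

lemma fps_cpow_deriv:
  assumes "fps_nth u 0 = 1"
  shows "u * fps_deriv (fps_cpow u s) = fps_const s * fps_cpow u s * fps_deriv u"
proof -
  have "fps_deriv (fps_binomial s) * (1 + fps_X) = fps_const s * fps_binomial s"
    by (simp add: fps_binomial_deriv fps_divide_unit inverse_mult_eq_1 mult.assoc)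
  then have "(fps_deriv (fps_binomial s) * (1 + fps_X)) oo (u - 1)
      = (fps_const s * fps_binomial s) oo (u - 1)" by simp
  then have "(fps_deriv (fps_binomial s) oo (u - 1)) * u = fps_const s * fps_cpow u s"
    using assms by (simp add: fps_cpow_def fps_compose_mult_distrib fps_compose_add_distrib
        fps_X_fps_compose_startby0)
  then show ?thesis
    using assms by (simp add: fps_cpow_def fps_compose_deriv algebra_simps)
qed

section \<open>The translation of \<alpha> by p, that is, exp (p D)\<close>

text \<open>The substitution \<open>\<alpha> \<mapsto> \<alpha> + p\<close> in \<open>\<alpha>\<^sup>c a(1 / \<alpha>)\<close>, divided by \<open>\<alpha>\<^sup>c\<close>.\<close>

definition translate :: "complex \<Rightarrow> complex \<Rightarrow> complex fps \<Rightarrow> complex fps" where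
  "translate p c a = fps_cpow (1 + fps_const p * fps_X) c *
     (a oo (fps_X * inverse (1 + fps_const p * fps_X)))"

lemma fps_cpow_linear_nth:
  "fps_nth (fps_cpow (1 + fps_const p * fps_X) c) n = p ^ n * (c gchoose n)"
  by (simp add: fps_cpow_def fps_compose_linear)

text \<open>The image of \<alpha>^(c-j): the substitution sends X to X / (1 + p X), and these
  denominators are absorbed in the exponent of 1 + p X.\<close>

lemma translate_monomial:
  "fps_cpow (1 + fps_const p * fps_X) c * (fps_X * inverse (1 + fps_const p * fps_X)) ^ j
     = fps_X ^ j * fps_cpow (1 + fps_const p * fps_X) (c - of_nat j)"
proof -
  let ?u = "1 + fps_const p * fps_X :: complex fps"
  have "fps_cpow ?u c = fps_cpow ?u (c - of_nat j) * ?u ^ j"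
    using fps_cpow_add[of ?u "c - of_nat j" "of_nat j"] fps_cpow_of_nat[of ?u j] by simp
  moreover have "?u ^ j * inverse ?u ^ j = 1"
    by (simp add: power_mult_distrib[symmetric] inverse_mult_eq_1')
  ultimately show ?thesis by (simp add: power_mult_distrib algebra_simps)
qed

lemma mult_compose_nth:
  fixes w a b :: "complex fps"
  assumes "fps_nth b 0 = 0"
  shows "fps_nth (w * (a oo b)) n = (\<Sum>j\<le>n. fps_nth a j * fps_nth (w * b ^ j) n)"
proof -
  have "fps_nth (w * (a oo b)) n
      = (\<Sum>m\<le>n. fps_nth w m * (\<Sum>j\<le>n. fps_nth a j * fps_nth (b ^ j) (n - m)))"
    unfolding fps_mult_nth atLeast0AtMost
  proof (intro sum.cong refl)
    fix m
    have "fps_nth (a oo b) (n - m) = (\<Sum>j\<le>n. fps_nth a j * fps_nth (b ^ j) (n - m))"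
      unfolding fps_compose_nth atLeast0AtMost
      using startsby_zero_power_prefix[OF assms] by (intro sum.mono_neutral_left) auto
    then show "fps_nth w m * fps_nth (a oo b) (n - m)
        = fps_nth w m * (\<Sum>j\<le>n. fps_nth a j * fps_nth (b ^ j) (n - m))" by simp
  qed
  also have "\<dots> = (\<Sum>j\<le>n. \<Sum>m\<le>n. fps_nth w m * (fps_nth a j * fps_nth (b ^ j) (n - m)))"
    unfolding sum_distrib_left by (rule sum.swap)
  also have "\<dots> = (\<Sum>j\<le>n. fps_nth a j * fps_nth (w * b ^ j) n)"
    unfolding fps_mult_nth sum_distrib_left atLeast0AtMost by (simp add: algebra_simps)
  finally show ?thesis .
qed

text \<open>Taylor's formula, which on each monomial \<alpha>^(c-j) is the binomial series of
  (\<alpha> + p)^(c-j).\<close>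

lemma diff_op_exp: "diff_op (fps_exp p) c a = translate p c a"
proof (rule fps_ext)
  fix n
  have "fps_nth (translate p c a) n
      = (\<Sum>j\<le>n. fps_nth a j * (p ^ (n - j) * ((c - of_nat j) gchoose (n - j))))"
    unfolding translate_def by (subst mult_compose_nth)
      (auto simp: translate_monomial fps_X_power_mult_nth fps_cpow_linear_nth intro!: sum.cong)
  also have "\<dots> = (\<Sum>k\<le>n. fps_nth a (n - k) * (p ^ k * ((c - of_nat (n - k)) gchoose k)))"
    by (rule sum.reindex_bij_witness[of _ "\<lambda>k. n - k" "\<lambda>k. n - k"]) auto
  also have "\<dots> = fps_nth (diff_op (fps_exp p) c a) n"
    unfolding diff_op_nth
  proof (intro sum.cong refl)
    fix k assume "k \<in> {..n}"
    then have "c - of_nat (n - k) - of_nat k + 1 = c - of_nat n + 1" by (simp add: of_nat_diff)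
    then show "fps_nth a (n - k) * (p ^ k * ((c - of_nat (n - k)) gchoose k))
        = fps_nth (fps_exp p) k * pochhammer (c - of_nat n + 1) k * fps_nth a (n - k)"
      unfolding gbinomial_pochhammer' by (simp only: fps_exp_nth of_nat_fact times_divide_eq_right times_divide_eq_left mult_ac)
  qed
  finally show "fps_nth (diff_op (fps_exp p) c a) n = fps_nth (translate p c a) n" ..
qed

lemma translate_mult: "translate p (c + d) (a * b) = translate p c a * translate p d b"
  by (simp add: translate_def fps_cpow_add fps_compose_mult_distrib mult_ac)

lemma translate_translate_minus: "translate (- p) c (translate p c a) = a"
  using diff_op_mult[of "fps_exp (- p)" "fps_exp p" c a] fps_exp_add_mult[of "- p" p]
  by (simp add: diff_op_exp diff_op_1)

text \<open>With exponent 1 the series 1 + b X stands for \<alpha> + b.\<close>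

lemma translate_1_linear:
  "translate p 1 (1 + fps_const b * fps_X) = 1 + fps_const (p + b) * fps_X"
proof -
  let ?u = "1 + fps_const p * fps_X :: complex fps"
  have "fps_cpow ?u 1 = ?u" using fps_cpow_of_nat[of ?u 1] by simp
  moreover have "(1 + fps_const b * fps_X) oo (fps_X * inverse ?u)
      = 1 + fps_const b * (fps_X * inverse ?u)"
    by (simp add: fps_compose_add_distrib fps_compose_mult_distrib fps_X_fps_compose_startby0)
  moreover have "?u * inverse ?u = 1" by (rule inverse_mult_eq_1') simp
  then have "?u * (1 + fps_const b * (fps_X * inverse ?u)) = ?u + fps_const b * fps_X"
    by algebra
  ultimately show ?thesis
    unfolding translate_def by (simp add: distrib_right flip: fps_const_add)
qed

text \<open>X a with exponent 0 and a with exponent - 1 represent the same series.\<close>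

lemma translate_0_X_mult: "translate p 0 (fps_X * a) = fps_X * translate p (- 1) a"
proof -
  let ?u = "1 + fps_const p * fps_X :: complex fps"
  have "fps_cpow ?u 0 = 1" using fps_cpow_of_nat[of ?u 0] by simp
  moreover have "fps_cpow ?u (- 1) = inverse ?u" by (simp add: fps_cpow_minus_1)
  ultimately show ?thesis
    by (simp add: translate_def fps_compose_mult_distrib fps_X_fps_compose_startby0 mult.assoc)
qed

lemma translate_minus_1_1: "translate p (- 1) 1 = inverse (1 + fps_const p * fps_X)"
  by (simp add: translate_def fps_cpow_minus_1)

lemma translate_nth_0: "fps_nth (translate p c a) 0 = fps_nth a 0"
  by (simp add: translate_def)

lemma translate_diff: "translate p c (a - b) = translate p c a - translate p c b"
  by (simp add: diff_op_exp[symmetric] diff_op_right_diff)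

lemma diff_op_nth_subdegree:
  "fps_nth (diff_op g c a) (subdegree a) = fps_nth g 0 * fps_nth a (subdegree a)"
proof -
  have "fps_nth (diff_op g c a) (subdegree a)
      = (\<Sum>k\<le>subdegree a. if k = 0 then fps_nth g 0 * fps_nth a (subdegree a) else 0)"
    unfolding diff_op_nth
    by (intro sum.cong refl) (auto intro!: nth_less_subdegree_zero)
  then show ?thesis by simp
qed

section \<open>The series of the theorem\<close>

text \<open>With exponent s this is p_s; with exponent s - 1 it is P_s = p_s / \<alpha>, the form
  used in the equations below.\<close>

definition p_fps :: "complex fps \<Rightarrow> complex \<Rightarrow> complex fps" where
  "p_fps f s = Abs_fps (\<lambda>n. pcoeff f n s)"

text \<open>The operator formula P_s = (D / f(D))^s \<alpha>^(s-1): applying D^n to \<alpha>^(s-1)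
  gives the binomial coefficient of s - 1 over n and the factor n! contained in q_n(s).\<close>

lemma p_fps_eq: "p_fps f s = diff_op (fps_cpow (fps_X / f) s) (s - 1) 1"
  by (simp add: fps_eq_iff p_fps_def pcoeff_def qpoly_def diff_op_right_1 gbinomial_pochhammer')

lemma p_fps_nth_0 [simp]: "fps_nth (p_fps f s) 0 = 1"
  by (simp add: p_fps_eq diff_op_right_1)

lemma fps_X_div_mult:
  fixes f :: "complex fps"
  assumes "fps_nth f 0 = 0" "fps_nth f 1 = 1"
  shows "fps_X / f * f = fps_X" "fps_nth (fps_X / f) 0 = 1"
proof -
  have sd: "subdegree f = 1" by (rule subdegreeI) (use assms in auto)
  have "f \<noteq> 0" using assms by auto
  with sd have "f dvd fps_X" by (simp add: fps_dvd_iff)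
  then show *: "fps_X / f * f = fps_X" by simp
  then have "fps_nth (fps_X / f * f) 1 = 1" by simp
  then show "fps_nth (fps_X / f) 0 = 1"
    using assms by (simp add: fps_mult_nth_1)
qed

text \<open>This is \<open>\<alpha> f(D) P\<^sub>s = (s - 1) f'(D) P\<^sub>s\<close>; the factor \<open>\<alpha>\<close> appears as \<open>X\<close> on the other side.\<close>

lemma p_fps_diff_equation:
  assumes "fps_nth f 0 = 0" "fps_nth f 1 = 1"
  shows "diff_op f (s - 1) (p_fps f s)
    = fps_X * (fps_const (s - 1) * diff_op (fps_deriv f) (s - 1) (p_fps f s))"
proof -
  define u where "u = fps_X / f"
  define w where "w = fps_cpow u s"
  define c where "c = s - 1"
  have uf: "u * f = fps_X" and u0: "fps_nth u 0 = 1"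
    using fps_X_div_mult[OF assms] by (auto simp: u_def)
  have "fps_deriv (u * f) = 1" by (simp add: uf)
  then have "fps_deriv u * f = 1 - u * fps_deriv f" by (simp add: algebra_simps)
  moreover have "u * fps_deriv w = fps_const s * w * fps_deriv u"
    unfolding w_def by (rule fps_cpow_deriv[OF u0])
  ultimately have "fps_X * f * fps_deriv w = fps_const s * w * (f - fps_X * fps_deriv f)"
    using uf by algebra
  \<comment> \<open>Since u f = X, the series f w is formally X^s f^(1-s); this is its logarithmic
    derivative, cleared of denominators.\<close>
  then have ode: "fps_X * fps_deriv (f * w)
      = fps_const s * (f * w) + fps_const (1 - s) * (fps_X * (fps_deriv f * w))"
    unfolding fps_deriv_mult fps_const_sub[symmetric] fps_const_1_eq_1 by algebra
  \<comment> \<open>Coefficients of X^(m+1) in \<open>ode\<close>. D^(m+1) \<alpha>^c has one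
    numerical factor more than D^m \<alpha>^c, namely c - m.\<close>
  have key: "(c - of_nat m) * fps_nth (f * w) (Suc m) = c * fps_nth (fps_deriv f * w) m" for m
  proof -
    have "fps_nth (fps_X * fps_deriv (f * w)) (Suc m)
      = fps_nth (fps_const s * (f * w) + fps_const (1 - s) * (fps_X * (fps_deriv f * w))) (Suc m)"
      by (simp only: ode)
    then have "of_nat (Suc m) * fps_nth (f * w) (Suc m)
        = s * fps_nth (f * w) (Suc m) + (1 - s) * fps_nth (fps_deriv f * w) m"
      by (simp only: fps_X_mult_nth fps_deriv_nth fps_add_nth fps_mult_left_const_nth) simp
    then show ?thesis by (simp add: c_def algebra_simps)
  qed
  have "diff_op (f * w) c 1 = fps_X * (fps_const c * diff_op (fps_deriv f * w) c 1)"
  proof (rule fps_ext)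
    fix n
    show "fps_nth (diff_op (f * w) c 1) n
        = fps_nth (fps_X * (fps_const c * diff_op (fps_deriv f * w) c 1)) n"
    proof (cases n)
      case 0
      then show ?thesis using assms by (simp add: diff_op_right_1)
    next
      case (Suc m)
      have "fps_nth (diff_op (f * w) c 1) n
          = (c - of_nat m) * fps_nth (f * w) (Suc m) * pochhammer (c - of_nat m + 1) m"
        by (simp add: diff_op_right_1 Suc pochhammer_rec del: fps_mult_nth_conv_upto_subdegree_left)
      also have "\<dots> = fps_nth (fps_X * (fps_const c * diff_op (fps_deriv f * w) c 1)) n"
        by (simp add: key Suc diff_op_right_1)
      finally show ?thesis .
    qed
  qed
  then show ?thesis
    by (simp add: diff_op_mult p_fps_eq c_def w_def u_def)
qed

section \<open>Difference equations satisfied by P_s\<close>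

text \<open>The condition \<open>c + d = - 1\<close> holds for the exponents \<open>c = s - 1\<close> and \<open>d = - s\<close> of \<open>P\<^sub>s\<close> and
  \<open>P\<^bsub>1-s\<^esub>\<close>.\<close>

lemma casoratian_eq_0:
  fixes u v :: "complex fps"
  assumes p: "p \<noteq> 0" and cd: "c + d = - 1"
    and u: "fps_const (p - A) * (1 - fps_const (c * p) * fps_X) * translate p c u + fps_const (2 * A - p) * u
       = fps_const A * (1 + fps_const (c * p) * fps_X) * translate (- p) c u"
    and v: "fps_const (p - A) * (1 - fps_const (d * p) * fps_X) * translate p d v + fps_const (2 * A - p) * v
       = fps_const A * (1 + fps_const (d * p) * fps_X) * translate (- p) d v"
  shows "(1 - fps_const (c * p) * fps_X) * translate p c u * v
       = (1 - fps_const (d * p) * fps_X) * translate p d v * u"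
proof -
  \<comment> \<open>The factors are taken with exponents 1, c and d, so that \<open>Y\<close> has
    exponent 1 + c + d = 0. For c = s - 1 and d = - s the linear factors are \<alpha> + (1-s) p and
    \<alpha> + s p, each divided by \<alpha>.\<close>
  define Y where "Y = (1 - fps_const (c * p) * fps_X) * translate p c u * v
       - (1 - fps_const (d * p) * fps_X) * translate p d v * u"
  have lin: "translate (- p) 1 (1 - fps_const (b * p) * fps_X) = 1 + fps_const (e * p) * fps_X"
    if "b + e = - 1" for b e
  proof -
    have "- p + - (b * p) = e * p" using that by algebra
    then show ?thesis using translate_1_linear[of "- p" "- (b * p)"]
      by (simp flip: fps_const_neg)
  qed
  have tr: "translate (- p) 0 (x * y * z) = translate (- p) 1 x * translate (- p) b y * translate (- p) e z"
    if "b + e = - 1" for b e x y z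
  proof -
    have "0 = 1 + b + e" using that by algebra
    then show ?thesis by (metis translate_mult)
  qed
  have "translate (- p) 0 Y = (1 + fps_const (d * p) * fps_X) * u * translate (- p) d v
      - (1 + fps_const (c * p) * fps_X) * v * translate (- p) c u"
    unfolding Y_def translate_diff using cd
    by (simp add: tr[of c d _ "translate p c u" v] tr[of d c _ "translate p d v" u] lin[of c d] lin[of d c] translate_translate_minus add.commute)
  \<comment> \<open>v times the equation for u minus u times the equation for v; the terms with 2 A
    - p cancel.\<close>
  then have "fps_const (p - A) * Y + fps_const A * translate (- p) 0 Y = 0"
    using u v unfolding Y_def by algebra
  then have "fps_nth (fps_const (p - A) * Y + fps_const A * translate (- p) 0 Y) (subdegree Y) = 0"
    by simp
  \<comment> \<open>Translation keeps the leading coefficient, and (p - A) + A = p.\<close>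
  then have "p * fps_nth Y (subdegree Y) = 0"
    by (simp add: diff_op_exp[symmetric] diff_op_nth_subdegree algebra_simps)
  then have "Y = 0" using p by simp
  then show ?thesis by (simp add: Y_def)
qed

text \<open>Expanding the product shows that p^2 f(D) is a combination of the translations by p, 0
  and - p.\<close>

lemma exp_combination:
  assumes p: "p \<noteq> 0" and f: "f = Delta p * (1 - fps_const A * Delta (- p))"
  shows "fps_const (p ^ 2) * f
    = fps_const (p - A) * fps_exp p + fps_const (2 * A - p) - fps_const A * fps_exp (- p)"
proof -
  have 1: "fps_exp p * fps_exp (- p) = (1 :: complex fps)"
    using fps_exp_add_mult[of p "- p"] by simp
  have 2: "fps_const p * fps_const (1 / p) = 1" using p by simp
  have 3: "fps_const (2 * A - p) = 2 * fps_const A - fps_const p"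
    by (simp flip: fps_const_sub fps_const_mult add: numeral_fps_const)
  have 4: "fps_const (p - A) = fps_const p - fps_const A" by simp
  have 5: "f = fps_const (1 / p) * (fps_exp p - 1)
      * (1 - fps_const A * (- fps_const (1 / p) * (fps_exp (- p) - 1)))"
    using p by (simp add: f Delta_def)
  have 6: "fps_const (p ^ 2) = fps_const p * fps_const p" by (simp add: power2_eq_square)
  show ?thesis
    unfolding 3 4 6 using 1 2 5 by algebra
qed

lemma p_fps_translate_equation:
  assumes p: "p \<noteq> 0" and f: "f = Delta p * (1 - fps_const A * Delta (- p))"
    and f01: "fps_nth f 0 = 0" "fps_nth f 1 = 1" and c: "c = s - 1"
  shows "fps_const (p - A) * (1 - fps_const (c * p) * fps_X) * translate p c (p_fps f s)
       + fps_const (2 * A - p) * p_fps f s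
     = fps_const A * (1 + fps_const (c * p) * fps_X) * translate (- p) c (p_fps f s)"
proof -
  define u where "u = p_fps f s"
  note comb = exp_combination[OF p f]
  have "fps_const (p ^ 2) * fps_deriv f = fps_deriv (fps_const (p ^ 2) * f)" by simp
  also have "\<dots> = fps_const (p * (p - A)) * fps_exp p + fps_const (p * A) * fps_exp (- p)"
    unfolding comb by (simp add: algebra_simps flip: fps_const_mult fps_const_neg)
  finally have comb': "fps_const (p ^ 2) * fps_deriv f
    = fps_const (p * (p - A)) * fps_exp p + fps_const (p * A) * fps_exp (- p)" .
  have "fps_const (p ^ 2) * diff_op f c u
      = fps_const (p - A) * translate p c u + fps_const (2 * A - p) * u - fps_const A * translate (- p) c u"
    unfolding diff_op_const_mult[symmetric] comb
    using diff_op_const_mult[of "2 * A - p" 1 c u]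
    by (simp only: diff_op_add diff_op_diff diff_op_const_mult diff_op_exp diff_op_1 mult_1_right)
  moreover have "fps_const (p ^ 2) * diff_op (fps_deriv f) c u
      = fps_const (p * (p - A)) * translate p c u + fps_const (p * A) * translate (- p) c u"
    unfolding diff_op_const_mult[symmetric] comb'
    by (simp only: diff_op_add diff_op_const_mult diff_op_exp)
  moreover have "diff_op f c u = fps_X * (fps_const c * diff_op (fps_deriv f) c u)"
    unfolding c u_def by (rule p_fps_diff_equation[OF f01])
  moreover have "fps_const (p * (p - A)) = fps_const p * fps_const (p - A)"
    "fps_const (p * A) = fps_const p * fps_const A" "fps_const (c * p) = fps_const c * fps_const p"
    by simp_all
  ultimately show ?thesis unfolding u_def[symmetric] by algebra
qed

text \<open>The case p = 0. The coefficients obey a first order recursion whose factor (s + n) (s -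
  1 - n) is unchanged when s becomes 1 - s.\<close>

lemma p_fps_symmetric_quadratic:
  assumes f: "f = fps_X - fps_const A * fps_X ^ 2"
  shows "p_fps f s = p_fps f (1 - s)"
proof -
  have rec: "of_nat (Suc n) * fps_nth (p_fps f s) (Suc n)
      = A * ((s + of_nat n) * (s - 1 - of_nat n)) * fps_nth (p_fps f s) n" for s n
  proof -
    define c where "c = s - 1"
    define u where "u = p_fps f s"
    \<comment> \<open>\<open>z\<close> is the series of \<alpha> D P_s, so its n-th coefficient is
      (c - n) u_n.\<close>
    define z where "z = fps_const c * u - fps_X * fps_deriv u"
    have A2: "fps_const (2 * A) = 2 * fps_const A"
      by (simp flip: fps_const_mult add: numeral_fps_const)
    have f': "fps_deriv f = 1 - fps_const (2 * A) * fps_X"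
      unfolding f A2 by (simp add: power2_eq_square algebra_simps)
    have f2: "f = fps_X - fps_const A * (fps_X * fps_X)" by (simp add: f power2_eq_square)
    have X: "diff_op fps_X c u = fps_X * z" by (simp add: diff_op_X z_def)
    have "diff_op f c u = fps_X * (fps_const c * diff_op (fps_deriv f) c u)"
      unfolding c_def u_def by (rule p_fps_diff_equation) (auto simp: f power2_eq_square)
    moreover have "diff_op f c u
        = fps_X * z - fps_const A * (fps_X * (fps_const c * (fps_X * z) - fps_X * (z + fps_X * fps_deriv z)))"
      unfolding f2 diff_op_diff diff_op_const_mult unfolding diff_op_mult X
      by (simp add: diff_op_X algebra_simps)
    moreover have "diff_op (fps_deriv f) c u = u - fps_const (2 * A) * (fps_X * z)"
      unfolding f' by (simp only: diff_op_diff diff_op_const_mult X diff_op_1)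
    ultimately have "fps_X * fps_X * fps_deriv u
        = fps_X * fps_X * (fps_const A * (fps_const c * z + z + fps_X * fps_deriv z))"
      using z_def A2 by algebra
    then have "fps_deriv u = fps_const A * (fps_const c * z + z + fps_X * fps_deriv z)"
      by simp
    then have "fps_nth (fps_deriv u) n
        = fps_nth (fps_const A * (fps_const c * z + z + fps_X * fps_deriv z)) n" by simp
    moreover have euler: "fps_nth (fps_X * fps_deriv h) n = of_nat n * fps_nth h n" for h :: "complex fps"
      by (cases n) auto
    moreover have "fps_nth z n = (c - of_nat n) * fps_nth u n"
      unfolding z_def fps_sub_nth euler by (simp add: algebra_simps)
    ultimately have "of_nat (Suc n) * fps_nth u (Suc n)
        = A * ((c + 1 + of_nat n) * ((c - of_nat n) * fps_nth u n))"
      by (simp only: fps_deriv_nth fps_mult_left_const_nth fps_add_nth) (simp add: algebra_simps)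
    then show ?thesis by (simp add: u_def c_def algebra_simps)
  qed
  show ?thesis
  proof (rule fps_ext)
    fix n
    show "fps_nth (p_fps f s) n = fps_nth (p_fps f (1 - s)) n"
    proof (induction n)
      case (Suc n)
      have "of_nat (Suc n) * fps_nth (p_fps f s) (Suc n)
          = of_nat (Suc n) * fps_nth (p_fps f (1 - s)) (Suc n)"
        unfolding rec Suc by (simp add: algebra_simps)
      then show ?case by (simp del: of_nat_Suc)
    qed simp
  qed
qed

section \<open>Logarithmic derivatives\<close>

text \<open>The series \<open>\<alpha> H' / H\<close> for \<open>H = \<alpha>\<^sup>c h(1 / \<alpha>)\<close>.\<close>

definition log_deriv :: "complex \<Rightarrow> complex fps \<Rightarrow> complex fps" where
  "log_deriv c h = fps_const c - fps_X * (fps_deriv h * inverse h)"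

lemma log_deriv_mult_self:
  assumes "fps_nth h 0 \<noteq> 0"
  shows "log_deriv c h * h = fps_const c * h - fps_X * fps_deriv h"
proof -
  have "inverse h * h = 1" by (rule inverse_mult_eq_1[OF assms])
  then show ?thesis unfolding log_deriv_def by algebra
qed

text \<open>Logarithmic derivative of (\<alpha> - a) H(\<alpha>+p) = (\<alpha> - b) H(\<alpha>).
  With exponent - 1, \<open>log_deriv c h\<close> stands for H' / H and the two inverses for 1 /
  (\<alpha> - b) and 1 / (\<alpha> - a).\<close>

lemma translate_log_deriv:
  assumes h: "fps_nth h 0 \<noteq> 0"
    and shift: "(1 - fps_const a * fps_X) * translate p c h = (1 - fps_const b * fps_X) * h"
  shows "translate p (- 1) (log_deriv c h) - log_deriv c h
       = inverse (1 - fps_const b * fps_X) - inverse (1 - fps_const a * fps_X)"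
proof -
  define M where "M = log_deriv c h"
  define z where "z = translate p c h"
  have Mh: "M * h = fps_const c * h - fps_X * fps_deriv h"
    unfolding M_def by (rule log_deriv_mult_self[OF h])
  have "translate p c (diff_op fps_X c h) = diff_op fps_X c z"
    unfolding z_def diff_op_exp[symmetric] diff_op_mult[symmetric] by (simp add: mult.commute)
  then have "translate p c (fps_X * M * h) = fps_X * (fps_const c * z - fps_X * fps_deriv z)"
    by (simp add: diff_op_X Mh mult.assoc)
  moreover have "translate p c (fps_X * M * h) = fps_X * translate p (- 1) M * z"
    using translate_mult[of p 0 c "fps_X * M" h] by (simp add: translate_0_X_mult z_def)
  ultimately have TMz: "translate p (- 1) M * z = fps_const c * z - fps_X * fps_deriv z"
    by (simp add: mult.assoc)
  define B where "B = 1 - fps_const b * fps_X"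
  define Q where "Q = 1 - fps_const a * fps_X"
  have inv: "Q * inverse Q = 1" "B * inverse B = 1"
    by (simp_all add: B_def Q_def inverse_mult_eq_1')
  have Qz: "Q * z = B * h" using shift by (simp add: Q_def B_def z_def)
  have "fps_deriv (Q * z) = fps_deriv (B * h)" by (simp add: Qz)
  then have d: "Q * fps_deriv z - fps_const a * z = B * fps_deriv h - fps_const b * h"
    by (simp add: Q_def B_def algebra_simps)
  \<comment> \<open>Both sides are compared after multiplication by Q z = B h, which clears all
    denominators.\<close>
  have "(translate p (- 1) M - M) * (Q * z) = Q * (translate p (- 1) M * z) - B * (M * h)"
    using Qz by algebra
  also have "\<dots> = h - z"
    using Qz d unfolding TMz Mh B_def Q_def by algebra
  also have "\<dots> = (inverse B - inverse Q) * (Q * z)"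
    using inv Qz by algebra
  finally have "(translate p (- 1) M - M) * (Q * z) = (inverse B - inverse Q) * (Q * z)" .
  moreover have "fps_nth (Q * z) 0 \<noteq> 0"
    using h by (simp add: Q_def z_def translate_nth_0)
  then have "Q * z \<noteq> 0" by auto
  ultimately show ?thesis by (simp add: M_def B_def Q_def)
qed

lemma Delta_nth: "fps_nth (Delta p) n = (if n = 0 then 0 else p ^ (n - 1) / fact n)"
  by (cases n) (auto simp: Delta_def algebra_simps)

definition fps_dilate :: "complex \<Rightarrow> complex fps \<Rightarrow> complex fps" where
  "fps_dilate c g = g oo (fps_const c * fps_X)"

lemma fps_dilate_nth: "fps_nth (fps_dilate c g) n = c ^ n * fps_nth g n"
  by (simp add: fps_dilate_def fps_compose_linear)

text \<open>With S = e^(spx) and R = e^((1-s)px) one has e^(px) = S R and p^2 f = (S R - 1) (p - A +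
  A / (S R)). Multiplied by S - R, the second factor becomes p^2 (f(sx) - f((1-s)x)).\<close>

lemma dilate_difference:
  assumes p: "p \<noteq> 0" and f: "f = Delta p * (1 - fps_const A * Delta (- p))"
  shows "f * (fps_exp (s * p) - fps_exp ((1 - s) * p))
       = (fps_exp p - 1) * (fps_dilate s f - fps_dilate (1 - s) f)"
proof -
  define P where "P = fps_const (p ^ 2)"
  have dil: "P * fps_dilate b f
      = fps_const (p - A) * fps_exp (b * p) + fps_const (2 * A - p) - fps_const A * fps_exp (- (b * p))" for b
  proof -
    have "P * fps_dilate b f = fps_dilate b (P * f)"
      by (simp add: fps_dilate_def P_def fps_const_mult_apply_left)
    then show ?thesis
      unfolding P_def exp_combination[OF p f]
      by (simp add: fps_eq_iff fps_dilate_nth power_mult_distrib power_minus' algebra_simps)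
  qed
  define S S' R R' where "S = fps_exp (s * p)" "S' = fps_exp (- (s * p))"
    "R = fps_exp ((1 - s) * p)" "R' = fps_exp (- ((1 - s) * p))"
  have inv: "S * S' = 1" "R * R' = 1"
    by (simp_all add: S_S'_R_R'_def fps_exp_add_mult[symmetric])
  have E: "fps_exp p = S * R" "fps_exp (- p) = S' * R'"
    by (simp_all add: S_S'_R_R'_def fps_exp_add_mult[symmetric] algebra_simps)
  define a b where "a = fps_const (p - A)" "b = fps_const A"
  have m: "fps_const (2 * A - p) = b - a" by (simp add: a_b_def)
  have "P * (f * (S - R)) = (a * (S * R) + (b - a) - b * (S' * R')) * (S - R)"
    using exp_combination[OF p f] by (simp only: E P_def a_b_def[symmetric] m mult.assoc[symmetric])
  also have "\<dots> = (S * R - 1) * ((a * S + (b - a) - b * S') - (a * R + (b - a) - b * R'))"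
    using inv by algebra
  also have "\<dots> = (S * R - 1) * (P * fps_dilate s f - P * fps_dilate (1 - s) f)"
    unfolding dil by (simp only: S_S'_R_R'_def a_b_def[symmetric] m)
  finally have "P * (f * (fps_exp (s * p) - fps_exp ((1 - s) * p)))
       = P * ((fps_exp p - 1) * (fps_dilate s f - fps_dilate (1 - s) f))"
    by (simp only: E S_S'_R_R'_def[symmetric] right_diff_distrib[symmetric] mult.left_commute)
  moreover have "P \<noteq> 0" using p by (simp add: P_def)
  ultimately show ?thesis by simp
qed

lemma fps_eq_inverse_mult:
  fixes u v :: "complex fps"
  assumes "fps_nth v 0 \<noteq> 0"
  shows "u = v * (u * inverse v)"
  using inverse_mult_eq_1'[OF assms] by algebra

text \<open>This is D applied to the first identity: with exponent - 1 the two arguments stand for D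
  ln (p_s / p_{1-s}) and D ln \<alpha>.\<close>

lemma diff_op_log_deriv:
  assumes f: "f = Delta p * (1 - fps_const A * Delta (- p))"
  shows "diff_op f (- 1) (log_deriv (2 * s - 1) (p_fps f s * inverse (p_fps f (1 - s))))
       = diff_op (fps_dilate s f - fps_dilate (1 - s) f) (- 1) 1"
proof (cases "p = 0")
  case True
  then have f': "f = fps_X - fps_const A * fps_X ^ 2"
    by (simp add: f Delta_def power2_eq_square algebra_simps)
  have "p_fps f s * inverse (p_fps f (1 - s)) = 1"
    unfolding p_fps_symmetric_quadratic[OF f', of s] by (rule inverse_mult_eq_1') simp
  then have "log_deriv (2 * s - 1) (p_fps f s * inverse (p_fps f (1 - s))) = fps_const (2 * s - 1) * 1"
    by (simp add: log_deriv_def)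
  \<comment> \<open>f has only terms of degree 1 and 2, and s^k - (1-s)^k = 2 s - 1 for k = 1 and
    for k = 2.\<close>
  moreover have "fps_const (2 * s - 1) * f = fps_dilate s f - fps_dilate (1 - s) f"
  proof (rule fps_ext)
    fix n :: nat
    consider "n = 0" | "n = 1" | "n = 2" | "n > 2" by linarith
    then show "fps_nth (fps_const (2 * s - 1) * f) n = fps_nth (fps_dilate s f - fps_dilate (1 - s) f) n"
      by cases (auto simp: f' fps_dilate_nth fps_X_power_iff power2_eq_square algebra_simps)
  qed
  ultimately show ?thesis
    by (simp only: diff_op_right_const_mult diff_op_const_mult[symmetric])
next
  case p: False
  define u v c d where "u = p_fps f s" "v = p_fps f (1 - s)" "c = s - 1" "d = - s"
  define h where "h = u * inverse v"
  define M where "M = log_deriv (2 * s - 1) h"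
  have f01: "fps_nth f 0 = 0" "fps_nth f 1 = 1"
    by (simp_all add: f fps_mult_nth_1 Delta_nth)
  have uv: "fps_nth u 0 = 1" "fps_nth v 0 = 1" by (simp_all add: u_v_c_d_def)
  have vh: "u = v * h"
    unfolding h_def by (rule fps_eq_inverse_mult) (simp add: uv)
  have tu: "translate p c u = translate p d v * translate p (2 * s - 1) h"
  proof -
    have "c = d + (2 * s - 1)" by (simp add: u_v_c_d_def)
    then show ?thesis by (simp only: vh translate_mult)
  qed
  have "(1 - fps_const (c * p) * fps_X) * translate p c u * v
       = (1 - fps_const (d * p) * fps_X) * translate p d v * u"
    unfolding u_v_c_d_def
    by (rule casoratian_eq_0[OF p _ p_fps_translate_equation[OF p f f01 refl]
          p_fps_translate_equation[OF p f f01]]) simp_all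
  \<comment> \<open>After the substitution u = v h a common nonzero factor cancels, which leaves a
    first order difference equation for h.\<close>
  then have "(translate p d v * v) * ((1 - fps_const (c * p) * fps_X) * translate p (2 * s - 1) h)
      = (translate p d v * v) * ((1 - fps_const (d * p) * fps_X) * h)"
    unfolding tu by (simp only: vh mult_ac)
  moreover have "fps_nth (translate p d v * v) 0 \<noteq> 0"
    by (simp add: translate_nth_0 uv)
  then have "translate p d v * v \<noteq> 0" by auto
  ultimately have "(1 - fps_const (c * p) * fps_X) * translate p (2 * s - 1) h
      = (1 - fps_const (d * p) * fps_X) * h"
    using mult_left_cancel by blast
  then have "translate p (- 1) M - M
      = inverse (1 - fps_const (d * p) * fps_X) - inverse (1 - fps_const (c * p) * fps_X)"
    unfolding M_def by (rule translate_log_deriv[rotated]) (simp add: h_def uv)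
  also have "1 - fps_const (d * p) * fps_X = 1 + fps_const (s * p) * fps_X"
    by (simp add: u_v_c_d_def flip: fps_const_neg)
  also have "1 - fps_const (c * p) * fps_X = 1 + fps_const ((1 - s) * p) * fps_X"
    by (simp add: u_v_c_d_def fps_eq_iff algebra_simps)
  finally have expM: "diff_op (fps_exp p - 1) (- 1) M
      = diff_op (fps_exp (s * p) - fps_exp ((1 - s) * p)) (- 1) 1"
    by (simp only: diff_op_diff diff_op_exp diff_op_1 translate_minus_1_1)
  define g where "g = fps_dilate s f - fps_dilate (1 - s) f"
  \<comment> \<open>f(D) commutes with e^(pD) - 1, and \<open>dilate_difference\<close> brings out
    the same factor on the right. It can be cancelled because the exponent - 1 is not a natural
    number.\<close>
  have "diff_op (fps_exp p - 1) (- 1) (diff_op f (- 1) M) = diff_op f (- 1) (diff_op (fps_exp p - 1) (- 1) M)"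
    unfolding diff_op_mult[symmetric] by (simp only: mult.commute)
  also have "\<dots> = diff_op (fps_exp p - 1) (- 1) (diff_op g (- 1) 1)"
    unfolding expM diff_op_mult[symmetric] g_def dilate_difference[OF p f] ..
  finally have zero: "diff_op (fps_exp p - 1) (- 1) (diff_op f (- 1) M - diff_op g (- 1) 1) = 0"
    by (simp add: diff_op_right_diff)
  have "(- 1 :: complex) \<noteq> of_nat n" for n
  proof
    assume "(- 1 :: complex) = of_nat n"
    then have "(of_nat n :: complex) = - 1" by (rule sym)
    then have "(of_nat (Suc n) :: complex) = 0" unfolding of_nat_Suc by simp
    then show False by (simp only: of_nat_eq_0_iff nat.distinct)
  qed
  from diff_op_eq_0D[OF _ _ this zero] have "diff_op f (- 1) M - diff_op g (- 1) 1 = 0"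
    using p by simp
  then show ?thesis by (simp add: M_def g_def h_def u_v_c_d_def)
qed

text \<open>g(D) is D composed with (g/x)(D), and D \<alpha>^(-1-n) = - (n+1)
  \<alpha>^(-2-n).\<close>

lemma diff_op_shift:
  assumes "fps_nth g 0 = 0"
  shows "fps_nth (diff_op g (- 1) a) (Suc n)
    = - of_nat (Suc n) * fps_nth (diff_op (fps_shift 1 g) (- 1) a) n"
  unfolding diff_op_nth sum.atMost_Suc_shift sum_distrib_left
  using assms by (simp add: pochhammer_rec algebra_simps sum_distrib_left sum.distrib)

text \<open>D is injective on series with exponents -1, -2, and so on. This permits the passage from
  f(D) D ln h back to f(D) ln h, which is (f/x)(D) applied to D ln h.\<close>

lemma diff_op_shift_cong:
  assumes "fps_nth g 0 = 0" "fps_nth h 0 = 0" "diff_op g (- 1) a = diff_op h (- 1) b"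
  shows "diff_op (fps_shift 1 g) (- 1) a = diff_op (fps_shift 1 h) (- 1) b"
proof (rule fps_ext)
  fix n
  have "- of_nat (Suc n) * fps_nth (diff_op (fps_shift 1 g) (- 1) a) n
      = - of_nat (Suc n) * fps_nth (diff_op (fps_shift 1 h) (- 1) b) n"
    by (metis assms diff_op_shift)
  then show "fps_nth (diff_op (fps_shift 1 g) (- 1) a) n = fps_nth (diff_op (fps_shift 1 h) (- 1) b) n"
    by (simp del: of_nat_Suc)
qed

section \<open>Operators on logarithmic series\<close>

lemma ls_add: "ls c a b + ls c a' b' = ls c (a + a') (b + b')"
  by (rule ext) (simp add: ls_def sum.distrib[symmetric])

lemma ls_diff: "ls c a b - ls c a' b' = ls c (a - a') (b - b')"
  by (rule ext) (simp add: ls_def sum_subtractf[symmetric])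

lemma ls_D_funpow:
  "(ls_D ^^ k) (ls c a 0)
     = ls (c - of_nat k) (Abs_fps (\<lambda>j. pochhammer (c - of_nat (k + j) + 1) k * fps_nth a j)) 0"
proof (induction k)
  case 0
  have "Abs_fps (fps_nth a) = a" by (simp add: fps_eq_iff)
  then show ?case by simp
next
  case (Suc k)
  show ?case
    unfolding funpow.simps comp_apply Suc ls_D_ls
    by (rule arg_cong3[of _ _ _ _ _ _ ls]) (auto simp: fps_eq_iff pochhammer_rec algebra_simps)
qed

text \<open>Since \<open>g\<^sub>0 = 0\<close>, one factor \<open>D\<close> can be split off \<open>g(cD)\<close>, and it removes the logarithm.\<close>

lemma ls_op_log:
  assumes g: "fps_nth g 0 = 0"
  shows "ls_op g c (ls 0 a (fps_const d))
    = ls (- 1) (diff_op (fps_shift 1 (fps_dilate c g)) (- 1) (fps_const d - fps_X * fps_deriv a)) 0"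
    (is "ls_op g c ?F = ls _ ?R 0")
proof
  fix q
  \<comment> \<open>\<open>M\<close> is the series of \<alpha> D F: D turns d ln \<alpha> into d /
    \<alpha> and a(X) into - X a'(X) / \<alpha>.\<close>
  define M where "M = fps_const d - fps_X * fps_deriv a"
  have "ls_D ?F = ls (- 1) M 0"
  proof -
    have "fps_nth (fps_X * fps_deriv a) n = of_nat n * fps_nth a n" for n
      by (cases n) auto
    then show ?thesis
      unfolding ls_D_ls by (intro arg_cong3[of _ _ _ _ _ _ ls]) (auto simp: fps_eq_iff M_def)
  qed
  then have D: "(ls_D ^^ Suc k) ?F
      = ls (- 1 - of_nat k) (Abs_fps (\<lambda>j. pochhammer (- 1 - of_nat (k + j) + 1) k * fps_nth M j)) 0" for k
    unfolding funpow_Suc_right comp_apply by (simp only: ls_D_funpow)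
  define t where "t = (\<lambda>k. (fps_nth g k * c ^ k * fst ((ls_D ^^ k) ?F q),
      fps_nth g k * c ^ k * snd ((ls_D ^^ k) ?F q)))"
  have t0: "t k = 0" if "(ls_D ^^ k) ?F q = 0 \<or> k = 0" for k
    using that g by (auto simp: t_def zero_prod_def)
  have op: "ls_op g c ?F q = sum t {k. (ls_D ^^ k) ?F q \<noteq> 0}"
    by (simp add: ls_op_def t_def)
  show "ls_op g c ?F q = ls (- 1) ?R 0 q"
  proof (cases "\<exists>n::nat. q = - 1 - of_nat n")
    case True
    then obtain n :: nat where q: "q = - 1 - of_nat n" by blast
    have in_range: "(ls_D ^^ Suc k) ?F q = (pochhammer (- 1 - of_nat n + 1) k * fps_nth M (n - k), 0)"
      if "k \<le> n" for k
    proof -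
      have "q = - 1 - of_nat k - of_nat (n - k)" using that by (simp add: q of_nat_diff)
      then show ?thesis using that by (simp only: D ls_nth) simp
    qed
    have out_range: "(ls_D ^^ Suc k) ?F q = 0" if "k > n" for k
      unfolding D
    proof (rule ls_outside)
      fix j
      show "q \<noteq> - 1 - of_nat k - of_nat j"
      proof
        assume "q = - 1 - of_nat k - of_nat j"
        then have "(of_nat n :: complex) = of_nat (k + j)" by (simp add: q algebra_simps)
        then show False using that by (simp only: of_nat_eq_iff)
      qed
    qed
    \<comment> \<open>The exponents in D^(k+1) F start at - 1 - k and descend, so only orders up to
      n + 1 reach q = - 1 - n.\<close>
    have "{k. (ls_D ^^ k) ?F q \<noteq> 0} \<subseteq> {..Suc n}"
    proof
      fix k assume "k \<in> {k. (ls_D ^^ k) ?F q \<noteq> 0}"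
      then show "k \<in> {..Suc n}" using out_range by (cases k) (auto simp: not_le[symmetric])
    qed
    then have "ls_op g c ?F q = sum t {..Suc n}"
      unfolding op by (intro sum.mono_neutral_left) (auto intro: t0)
    also have "\<dots> = (\<Sum>k\<le>n. t (Suc k))"
      unfolding sum.atMost_Suc_shift by (simp add: t0)
    also have "\<dots> = (\<Sum>k\<le>n. (fps_nth (fps_shift 1 (fps_dilate c g)) k *
        pochhammer (- 1 - of_nat n + 1) k * fps_nth M (n - k), 0))"
    proof (intro sum.cong refl)
      fix k assume "k \<in> {..n}"
      then have "k \<le> n" by simp
      then show "t (Suc k) = (fps_nth (fps_shift 1 (fps_dilate c g)) k *
          pochhammer (- 1 - of_nat n + 1) k * fps_nth M (n - k), 0)"
        unfolding t_def in_range[OF \<open>k \<le> n\<close>] by (simp add: fps_dilate_nth)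
    qed
    also have "\<dots> = (fps_nth ?R n, 0)"
      unfolding diff_op_nth M_def by (simp add: prod_eq_iff fst_sum snd_sum)
    finally show ?thesis by (simp only: q ls_nth fps_zero_nth)
  next
    case False
    have "(ls_D ^^ Suc k) ?F q = 0" for k
      unfolding D
    proof (rule ls_outside)
      fix j
      have "q \<noteq> - 1 - of_nat (k + j)" using False by blast
      then show "q \<noteq> - 1 - of_nat k - of_nat j" by (simp add: algebra_simps)
    qed
    then have "t k = 0" for k by (cases k) (simp_all only: t0 simp_thms)
    then have "ls_op g c ?F q = 0" by (simp add: op)
    moreover have "ls (- 1) ?R 0 q = 0" using False by (intro ls_outside) blast
    ultimately show ?thesis by simp
  qed
qed

text \<open>Separates the contributions of p_s and p_{1-s}, so that each can be differentiated in s
  by itself.\<close>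

lemma log_deriv_quotient:
  assumes "fps_nth u 0 \<noteq> 0" "fps_nth v 0 \<noteq> 0"
  shows "log_deriv c (u * inverse v)
    = fps_const c - fps_X * (fps_deriv u * inverse u) + fps_X * (fps_deriv v * inverse v)"
proof -
  define h where "h = u * inverse v"
  define M where "M = fps_const c - fps_X * (fps_deriv u * inverse u) + fps_X * (fps_deriv v * inverse v)"
  have inv: "u * inverse u = 1" "v * inverse v = 1"
    using assms by (simp_all add: inverse_mult_eq_1')
  have h0: "fps_nth h 0 \<noteq> 0" using assms by (simp add: h_def)
  have uvh: "u = v * h" unfolding h_def by (rule fps_eq_inverse_mult[OF assms(2)])
  then have "fps_deriv u = fps_deriv (v * h)" by simp
  then have "fps_deriv u = v * fps_deriv h + fps_deriv v * h" by simp
  then have "log_deriv c h * h * (v * v) = M * h * (v * v)"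
    unfolding log_deriv_mult_self[OF h0] M_def using inv uvh by algebra
  moreover have "h * (v * v) \<noteq> 0" using h0 assms by auto
  ultimately show ?thesis unfolding h_def[symmetric] M_def[symmetric]
    by (metis mult.assoc mult_right_cancel)
qed

lemma fps_deriv_ln_compose:
  fixes h :: "complex fps"
  assumes "fps_nth h 0 = 1"
  shows "fps_deriv (fps_ln 1 oo (h - 1)) = fps_deriv h * inverse h"
proof -
  have "inverse (1 + fps_X) oo (h - 1) = inverse ((1 + fps_X) oo (h - 1))"
    using assms by (intro fps_inverse_compose) auto
  also have "(1 + fps_X) oo (h - 1) = h"
    using assms by (simp add: fps_compose_add_distrib fps_X_fps_compose_startby0)
  finally show ?thesis
    using assms by (simp add: fps_compose_deriv fps_ln_deriv)
qed

section \<open>Differentiation in the parameter s\<close>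

definition has_coeff_deriv :: "(complex \<Rightarrow> complex fps) \<Rightarrow> complex fps \<Rightarrow> complex \<Rightarrow> bool" where
  "has_coeff_deriv F F' s \<longleftrightarrow>
     (\<forall>n. ((\<lambda>s. fps_nth (F s) n) has_field_derivative fps_nth F' n) (at s))"

lemma has_coeff_deriv_unique:
  "has_coeff_deriv F F' s \<Longrightarrow> has_coeff_deriv F F'' s \<Longrightarrow> F' = F''"
  unfolding has_coeff_deriv_def fps_eq_iff by (metis DERIV_unique)

lemma has_coeff_deriv_const: "has_coeff_deriv (\<lambda>s. a) 0 s"
  by (simp add: has_coeff_deriv_def)

lemma has_coeff_deriv_add:
  "has_coeff_deriv F F' s \<Longrightarrow> has_coeff_deriv G G' s \<Longrightarrow> has_coeff_deriv (\<lambda>s. F s + G s) (F' + G') s"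
  by (auto simp: has_coeff_deriv_def intro!: derivative_intros)

lemma has_coeff_deriv_diff:
  "has_coeff_deriv F F' s \<Longrightarrow> has_coeff_deriv G G' s \<Longrightarrow> has_coeff_deriv (\<lambda>s. F s - G s) (F' - G') s"
  by (auto simp: has_coeff_deriv_def intro!: derivative_intros)

lemma has_coeff_deriv_mult:
  assumes "has_coeff_deriv F F' s" "has_coeff_deriv G G' s"
  shows "has_coeff_deriv (\<lambda>s. F s * G s) (F' * G s + F s * G') s"
  unfolding has_coeff_deriv_def
proof
  fix n
  have [derivative_intros]: "((\<lambda>s. fps_nth (F s) m) has_field_derivative fps_nth F' m) (at s)"
    "((\<lambda>s. fps_nth (G s) m) has_field_derivative fps_nth G' m) (at s)" for m
    using assms by (auto simp: has_coeff_deriv_def)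
  show "((\<lambda>s. fps_nth (F s * G s) n) has_field_derivative fps_nth (F' * G s + F s * G') n) (at s)"
    unfolding fps_mult_nth fps_add_nth sum.distrib[symmetric]
    by (rule derivative_eq_intros refl)+ (simp add: mult.commute add.commute)
qed

lemma has_coeff_deriv_fps_deriv:
  "has_coeff_deriv F F' s \<Longrightarrow> has_coeff_deriv (\<lambda>s. fps_deriv (F s)) (fps_deriv F') s"
  by (auto simp: has_coeff_deriv_def intro!: DERIV_cmult)

lemma has_coeff_deriv_reflect:
  assumes "has_coeff_deriv F F' (1 - s)"
  shows "has_coeff_deriv (\<lambda>s. F (1 - s)) (- F') s"
  unfolding has_coeff_deriv_def
proof
  fix n
  have "((\<lambda>s. fps_nth (F s) n) has_field_derivative fps_nth F' n) (at (1 - s))"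
    using assms by (simp add: has_coeff_deriv_def)
  moreover have "((\<lambda>s. 1 - s) has_field_derivative - 1) (at s)"
    by (auto intro!: derivative_eq_intros)
  ultimately have "((\<lambda>s. fps_nth (F (1 - s)) n) has_field_derivative fps_nth F' n * - 1) (at s)"
    by (rule DERIV_chain2)
  then show "((\<lambda>s. fps_nth (F (1 - s)) n) has_field_derivative fps_nth (- F') n) (at s)"
    by simp
qed

lemma has_coeff_deriv_diff_op:
  assumes "has_coeff_deriv F F' s"
  shows "has_coeff_deriv (\<lambda>s. diff_op g c (F s)) (diff_op g c F') s"
  using assms unfolding has_coeff_deriv_def diff_op_nth by (auto intro!: DERIV_sum DERIV_cmult)

lemma has_coeff_deriv_inverse:
  assumes F: "has_coeff_deriv F F' s" and F0: "\<And>s. fps_nth (F s) 0 = 1"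
  shows "has_coeff_deriv (\<lambda>s. inverse (F s)) (- F' * (inverse (F s))\<^sup>2) s"
proof -
  \<comment> \<open>Induction along the recursion for the coefficients of an inverse gives
    differentiability only; the value of the derivative comes from differentiating the product of F
    and its inverse, which is 1.\<close>
  have "\<exists>D. ((\<lambda>s. fps_nth (inverse (F s)) n) has_field_derivative D) (at s)" for n
  proof (induction n rule: less_induct)
    case (less n)
    show ?case
    proof (cases n)
      case 0
      then show ?thesis using F0 by (auto intro!: exI[of _ 0])
    next
      case (Suc m)
      have "fps_nth (inverse (F s)) n = - (\<Sum>i=1..n. fps_nth (F s) i * fps_nth (inverse (F s)) (n - i))" for s
        using F0 Suc by (simp only: fps_inverse_def fps_nth_Abs_fps fps_right_inverse_constructor_rec) simp
      moreover have "\<exists>D. ((\<lambda>s. fps_nth (F s) i * fps_nth (inverse (F s)) (n - i)) has_field_derivative D) (at s)"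
        if "i \<in> {1..n}" for i
      proof -
        have "n - i < n" using that Suc by auto
        from less[OF this] obtain D where
          "((\<lambda>s. fps_nth (inverse (F s)) (n - i)) has_field_derivative D) (at s)" by blast
        moreover have "((\<lambda>s. fps_nth (F s) i) has_field_derivative fps_nth F' i) (at s)"
          using F by (simp add: has_coeff_deriv_def)
        ultimately show ?thesis by (intro exI) (rule DERIV_mult)
      qed
      then have "\<exists>D. \<forall>i\<in>{1..n}.
          ((\<lambda>s. fps_nth (F s) i * fps_nth (inverse (F s)) (n - i)) has_field_derivative D i) (at s)"
        by metis
      then obtain D where "\<And>i. i \<in> {1..n} \<Longrightarrow>
          ((\<lambda>s. fps_nth (F s) i * fps_nth (inverse (F s)) (n - i)) has_field_derivative D i) (at s)"
        by blast
      then have "((\<lambda>s. - (\<Sum>i=1..n. fps_nth (F s) i * fps_nth (inverse (F s)) (n - i)))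
          has_field_derivative - (\<Sum>i=1..n. D i)) (at s)"
        by (intro DERIV_minus DERIV_sum)
      ultimately show ?thesis by auto
    qed
  qed
  then obtain G where "\<And>n. ((\<lambda>s. fps_nth (inverse (F s)) n) has_field_derivative G n) (at s)"
    by metis
  then have G: "has_coeff_deriv (\<lambda>s. inverse (F s)) (Abs_fps G) s"
    by (simp add: has_coeff_deriv_def)
  have inv: "F s * inverse (F s) = 1" for s
    by (rule inverse_mult_eq_1') (simp add: F0)
  have "F' * inverse (F s) + F s * Abs_fps G = 0"
    using has_coeff_deriv_mult[OF F G] unfolding inv
    by (rule has_coeff_deriv_unique) (rule has_coeff_deriv_const)
  then have "Abs_fps G = - F' * (inverse (F s))\<^sup>2"
    using inv[of s] by algebra
  with G show ?thesis by simp
qed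

definition p_dot_fps :: "complex fps \<Rightarrow> complex \<Rightarrow> complex fps" where
  "p_dot_fps f s = Abs_fps (\<lambda>n. deriv (pcoeff f n) s)"

lemma has_coeff_deriv_p_fps: "has_coeff_deriv (p_fps f) (p_dot_fps f s) s"
proof -
  have "(\<lambda>s::complex. (s - a) gchoose k) field_differentiable at s" for a k s
  proof -
    have "(\<lambda>s::complex. \<Prod>i=0..<k. (s - a) - of_nat i) field_differentiable at s"
      by (induction k) (auto intro!: derivative_intros)
    then show ?thesis
      unfolding gbinomial_prod_rev by (intro derivative_intros) auto
  qed
  note [derivative_intros] = this this[of 0, simplified]
  have "pcoeff f n field_differentiable at s" for n s
    unfolding pcoeff_def qpoly_def fps_cpow_def fps_compose_nth fps_binomial_nth
    by (intro derivative_intros)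
  then show ?thesis
    by (auto simp: has_coeff_deriv_def p_fps_def p_dot_fps_def field_differentiable_derivI)
qed


text \<open>Here (x / f)^(-1) = f / x, so q_n(-1) / n! is the coefficient of x^(n+1) in f.\<close>

lemma pcoeff_minus_1:
  assumes "fps_nth f 0 = 0" "fps_nth f 1 = 1"
  shows "pcoeff f n (- 1) = fps_nth f (Suc n) * pochhammer (- 1 - of_nat n) n"
proof -
  have "fps_X * ((fps_X / f) * fps_shift 1 f) = fps_X * 1"
  proof -
    have "fps_X * fps_shift 1 f = f"
      using assms(1) by (simp add: fps_eq_iff)
    then show ?thesis
      by (metis fps_X_div_mult(1)[OF assms] mult.left_commute mult_1_right)
  qed
  then have "(fps_X / f) * fps_shift 1 f = 1"
    by (rule mult_left_cancel[THEN iffD1, rotated]) simp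
  then have "fps_cpow (fps_X / f) (- 1) = fps_shift 1 f"
    unfolding fps_cpow_minus_1[OF fps_X_div_mult(2)[OF assms]] by (rule fps_inverse_unique)
  moreover have "pcoeff f n (- 1) = fps_nth (p_fps f (- 1)) n" by (simp add: p_fps_def)
  ultimately show ?thesis by (simp add: p_fps_eq diff_op_right_1)
qed

text \<open>The derivative of s^(n+1) - (1-s)^(n+1) is (n+1) (s^n + (1-s)^n), and n + 1 turns the n!
  of D^n \<alpha>^(-1) into the (n+1)! of p_{-1}.\<close>

lemma has_coeff_deriv_dilate_difference:
  assumes "fps_nth f 0 = 0" "fps_nth f 1 = 1"
  shows "has_coeff_deriv (\<lambda>s. diff_op (fps_shift 1 (fps_dilate s f - fps_dilate (1 - s) f)) (- 1) 1)
    (Abs_fps (\<lambda>n. pcoeff f n (- 1) * s ^ n + pcoeff f n (- 1) * (1 - s) ^ n)) s"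
  unfolding has_coeff_deriv_def
proof
  fix n
  \<comment> \<open>Both sides are the Pochhammer symbol of order n + 1 at - 1 - n, with its first
    or its last factor split off.\<close>
  have "(- 1 - of_nat n :: complex) * pochhammer (- of_nat n) n
      = (- 1) * pochhammer (- 1 - of_nat n) n"
    using pochhammer_rec[of "- 1 - of_nat n :: complex" n] pochhammer_rec'[of "- 1 - of_nat n :: complex" n]
    by simp
  then have poch: "pochhammer (- 1 - of_nat n :: complex) n = (1 + of_nat n) * pochhammer (- of_nat n) n"
    by algebra
  show "((\<lambda>s. fps_nth (diff_op (fps_shift 1 (fps_dilate s f - fps_dilate (1 - s) f)) (- 1) 1) n)
      has_field_derivative
      fps_nth (Abs_fps (\<lambda>n. pcoeff f n (- 1) * s ^ n + pcoeff f n (- 1) * (1 - s) ^ n)) n) (at s)"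
    unfolding diff_op_right_1 fps_shift_nth fps_sub_nth fps_dilate_nth fps_nth_Abs_fps
      pcoeff_minus_1[OF assms] poch
    by (rule derivative_eq_intros refl)+ (simp add: algebra_simps)
qed

section \<open>Both identities for series with ln \<alpha>\<close>

theorem theorem2p1:
  fixes p A s :: complex and f :: "complex fps"
  assumes "f = Delta p * (1 - fps_const A * Delta (- p))"
  shows "ls_op f 1 (ls_ln (ls_div (p_series f s) (p_series f (1 - s))))
           = ls_op f s ln_alpha - ls_op f (1 - s) ln_alpha \<and>
         ls_op f 1 (ls_div (p_dot f s) (p_series f s) + ls_div (p_dot f (1 - s)) (p_series f (1 - s)))
           = p_minus1_scaled f s + p_minus1_scaled f (1 - s)"
proof
  have f01: "fps_nth f 0 = 0" "fps_nth f 1 = 1"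
    by (simp_all add: assms fps_mult_nth_1 Delta_nth)
  have dil1: "fps_dilate 1 f = f" by (simp add: fps_eq_iff fps_dilate_nth)
  have p_series: "p_series f s = ls s (p_fps f s) 0" for s
    by (simp add: p_series_def p_fps_def)
  define M where "M = (\<lambda>s. log_deriv (2 * s - 1) (p_fps f s * inverse (p_fps f (1 - s))))"
  have main: "diff_op (fps_shift 1 f) (- 1) (M s)
      = diff_op (fps_shift 1 (fps_dilate s f - fps_dilate (1 - s) f)) (- 1) 1" for s
    unfolding M_def using diff_op_log_deriv[OF assms]
    by (intro diff_op_shift_cong) (auto simp: f01 fps_dilate_nth)
  show "ls_op f 1 (ls_ln (ls_div (p_series f s) (p_series f (1 - s))))
      = ls_op f s ln_alpha - ls_op f (1 - s) ln_alpha"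
  proof -
    define h where "h = p_fps f s * inverse (p_fps f (1 - s))"
    have h0: "fps_nth h 0 = 1" and M: "M s = log_deriv (2 * s - 1) h" by (simp_all add: h_def M_def)
    have "ls_div (p_series f s) (p_series f (1 - s)) = ls (2 * s - 1) h 0"
      unfolding p_series h_def by (subst ls_div_ls) (auto simp: algebra_simps)
    then have "ls_ln (ls_div (p_series f s) (p_series f (1 - s)))
        = ls 0 (fps_ln 1 oo (h - 1)) (fps_const (2 * s - 1))"
      using h0 by (simp add: ls_ln_def ls_lead_exp)
    then have "ls_op f 1 (ls_ln (ls_div (p_series f s) (p_series f (1 - s))))
        = ls (- 1) (diff_op (fps_shift 1 f) (- 1) (M s)) 0"
      by (simp only: ls_op_log[OF f01(1)] dil1 fps_deriv_ln_compose[OF h0] M log_deriv_def)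
    also have "\<dots> = ls_op f s ln_alpha - ls_op f (1 - s) ln_alpha"
      using ls_op_log[OF f01(1), of _ 0 1]
      by (simp add: main[unfolded fps_shift_diff diff_op_diff One_nat_def] ln_alpha_def ls_diff)
    finally show ?thesis .
  qed
  show "ls_op f 1 (ls_div (p_dot f s) (p_series f s) + ls_div (p_dot f (1 - s)) (p_series f (1 - s)))
      = p_minus1_scaled f s + p_minus1_scaled f (1 - s)"
  proof -
    \<comment> \<open>\<open>N s\<close> is the part free of ln \<alpha> in the quotient of
      \<open>p_dot f s\<close> by p_s; the other part is ln \<alpha> itself.\<close>
    define N where "N = (\<lambda>s. p_dot_fps f s * inverse (p_fps f s))"
    have inv: "p_fps f s * inverse (p_fps f s) = 1" for s
      by (rule inverse_mult_eq_1') simp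
    have dinv: "fps_deriv (inverse (p_fps f s)) = - fps_deriv (p_fps f s) * (inverse (p_fps f s))\<^sup>2" for s
      by (rule fps_inverse_deriv) simp
    have "ls_div (p_dot f s) (p_series f s) = ls 0 (N s) 1" for s
    proof -
      have "p_dot f s = ls s (p_dot_fps f s) (p_fps f s)"
        by (simp add: p_dot_def p_dot_fps_def p_fps_def)
      then show ?thesis
        by (simp only: p_series) (subst ls_div_ls, auto simp: inv N_def)
    qed
    then have "ls_op f 1 (ls_div (p_dot f s) (p_series f s) + ls_div (p_dot f (1 - s)) (p_series f (1 - s)))
        = ls_op f 1 (ls 0 (N s + N (1 - s)) (fps_const 2))"
      by (simp add: ls_add numeral_fps_const[symmetric])
    also have "\<dots> = ls (- 1) (diff_op (fps_shift 1 f) (- 1)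
        (fps_const 2 - fps_X * fps_deriv (N s + N (1 - s)))) 0"
      by (simp add: ls_op_log[OF f01(1)] dil1)
    also have "diff_op (fps_shift 1 f) (- 1) (fps_const 2 - fps_X * fps_deriv (N s + N (1 - s)))
        = Abs_fps (\<lambda>n. pcoeff f n (- 1) * s ^ n + pcoeff f n (- 1) * (1 - s) ^ n)"
    proof -
      define L where "L = (\<lambda>s. fps_X * (fps_deriv (p_fps f s) * inverse (p_fps f s)))"
      \<comment> \<open>d/ds and X d/dX commute on the logarithm of \<open>p_fps f s\<close>, whose
        images under them are \<open>N s\<close> and \<open>L s\<close>.\<close>
      have "has_coeff_deriv L (fps_X * fps_deriv (N s)) s" for s
      proof -
        note P = has_coeff_deriv_p_fps[of f s]
        have "has_coeff_deriv L (0 * (fps_deriv (p_fps f s) * inverse (p_fps f s)) + fps_X *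
            (fps_deriv (p_dot_fps f s) * inverse (p_fps f s)
              + fps_deriv (p_fps f s) * (- p_dot_fps f s * (inverse (p_fps f s))\<^sup>2))) s"
          unfolding L_def
          by (intro has_coeff_deriv_mult has_coeff_deriv_const has_coeff_deriv_fps_deriv
              has_coeff_deriv_inverse P p_fps_nth_0)
        also have "0 * (fps_deriv (p_fps f s) * inverse (p_fps f s)) + fps_X *
            (fps_deriv (p_dot_fps f s) * inverse (p_fps f s)
              + fps_deriv (p_fps f s) * (- p_dot_fps f s * (inverse (p_fps f s))\<^sup>2))
            = fps_X * fps_deriv (N s)"
          by (simp add: N_def dinv algebra_simps)
        finally show ?thesis .
      qed
      note L = this this[THEN has_coeff_deriv_reflect]
      have "has_coeff_deriv (\<lambda>s. fps_const (2 * s - 1)) (fps_const 2) s"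
        unfolding has_coeff_deriv_def by (auto intro!: derivative_eq_intros)
      moreover have "M = (\<lambda>s. fps_const (2 * s - 1) - L s + L (1 - s))"
        unfolding M_def L_def by (subst log_deriv_quotient) auto
      \<comment> \<open>The chain rule at 1 - s reverses a sign, so that \<open>N s\<close> and
        \<open>N (1 - s)\<close> enter alike.\<close>
      ultimately have "has_coeff_deriv M
          (fps_const 2 - fps_X * fps_deriv (N s) + - (fps_X * fps_deriv (N (1 - s)))) s"
        by (simp only:) (intro has_coeff_deriv_add has_coeff_deriv_diff L)
      also have "fps_const 2 - fps_X * fps_deriv (N s) + - (fps_X * fps_deriv (N (1 - s)))
          = fps_const 2 - fps_X * fps_deriv (N s + N (1 - s))"
        by (simp add: algebra_simps)
      finally have "has_coeff_deriv (\<lambda>s. diff_op (fps_shift 1 f) (- 1) (M s))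
        (diff_op (fps_shift 1 f) (- 1) (fps_const 2 - fps_X * fps_deriv (N s + N (1 - s)))) s"
        by (rule has_coeff_deriv_diff_op)
      \<comment> \<open>Both sides of \<open>main\<close> are differentiated in s, and
        coefficientwise derivatives are unique.\<close>
      then show ?thesis
        unfolding main by (rule has_coeff_deriv_unique) (rule has_coeff_deriv_dilate_difference[OF f01])
    qed
    also have "ls (- 1) \<dots> 0 = p_minus1_scaled f s + p_minus1_scaled f (1 - s)"
      unfolding p_minus1_scaled_def ls_add by (intro arg_cong3[of _ _ _ _ _ _ ls]) (simp_all add: fps_eq_iff)
    finally show ?thesis .
  qed
qed

end
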